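(* Let $\mathbb K$ be a field of characteristic zero or at least $5$. Let $T\in\Lambda^3(\mathbb K^n)$ be an alternating tensor with a decomposition $T=\sum_{i=1}^r a_i\wedge b_i\wedge c_i$, where all terms $a_i\wedge b_i\wedge c_i$ are nonzero. Let $k$ denote the Kruskal rank of the collection of subspaces $U_i=\langle a_i,b_i,c_i\rangle$, $i=1,\dots,r$. If $2r\le 3k-1$, then the border skew rank of $T$ is $r$.
   Context: For a multiset $\{U_1,\dots,U_r\}$ of $r\ge1$ nonzero subspaces of $\mathbb K^n$, the Kruskal rank is the largest $\ell$ such that every sub-multiset of cardinality $\ell$ is in direct sum, i.e. $\dim(U_{i_1}+\dots+U_{i_\ell})=\dim U_{i_1}+\dots+\dim U_{i_\ell}$ for all pairwise distinct $i_1,\dots,i_\ell$. Here $x_1\wedge x_2\wedge x_3=\frac1{3!}\sum_{\sigma\in\mathfrak S_3}\operatorname{sgn}(\sigma)\,x_{\sigma(1)}\otimes x_{\sigma(2)}\otimes x_{\sigma(3)}$. The border skew rank of $T\in\Lambda^3(\mathbb K^n)$ is the smallest $s$ such that $T$ lies in the Zariski closure, in $\Lambda^3(\mathbb K^n)$, of $\{x_1+\dots+x_s\mid x_1,\dots,x_s\in Y\}$, where $Y=\{a\wedge b\wedge c\mid a,b,c\in\mathbb K^n\}$. *)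

theory Defs
  imports "HOL-Analysis.Analysis" "HOL-Combinatorics.Permutations"
begin

section \<open>Alternating tensors of order three\<close>

text \<open>The tensor space \<open>K\<^sup>n \<otimes> K\<^sup>n \<otimes> K\<^sup>n\<close> is identified with \<open>K\<close>-valued
  \<open>n \<times> n \<times> n\<close> arrays, that is, with the type \<^typ>\<open>'a ^ ('n \<times> 'n \<times> 'n)\<close>.  The permutations in
  \<open>S\<^sub>3\<close> act on the positions 0, 1, 2.\<close>

definition tensor3 :: "'a::field ^ 'n::finite \<Rightarrow> 'a ^ 'n \<Rightarrow> 'a ^ 'n \<Rightarrow> 'a ^ ('n \<times> 'n \<times> 'n)"
  where "tensor3 x y z = vec_lambda (\<lambda>(i, j, k). x $ i * y $ j * z $ k)"

definition wedge3 :: "'a::field ^ 'n::finite \<Rightarrow> 'a ^ 'n \<Rightarrow> 'a ^ 'n \<Rightarrow> 'a ^ ('n \<times> 'n \<times> 'n)"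
  where "wedge3 x y z =
    (1 / of_nat (fact 3)) *s (\<Sum>\<sigma> | \<sigma> permutes {..<3::nat}.
      of_int (sign \<sigma>) *s
        tensor3 ([x, y, z] ! \<sigma> 0) ([x, y, z] ! \<sigma> 1) ([x, y, z] ! \<sigma> 2))"

text \<open>Sign-equivariance under \<open>S\<^sub>3\<close> is the right notion of alternating tensor only
  outside characteristic 2, where it agrees with vanishing on repeated indices.\<close>

definition alternating3 :: "('a::field ^ ('n::finite \<times> 'n \<times> 'n)) set"
  where "alternating3 =
    {T. \<forall>\<sigma> i j k. \<sigma> permutes {..<3::nat} \<longrightarrow>
          T $ ([i, j, k] ! \<sigma> 0, [i, j, k] ! \<sigma> 1, [i, j, k] ! \<sigma> 2)
            = of_int (sign \<sigma>) * T $ (i, j, k)}"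


section \<open>Zariski closure\<close>

text \<open>Polynomials enter the Zariski topology on \<open>K\<close>-points only through their zeros, so they
  are represented by the functions they induce (over a finite field, distinct
  polynomials may induce the same function).\<close>

inductive polyfun :: "('a::field ^ 'm \<Rightarrow> 'a) \<Rightarrow> bool"
  where
    const: "polyfun (\<lambda>_. c)"
  | coord: "polyfun (\<lambda>x. x $ i)"
  | add: "polyfun p \<Longrightarrow> polyfun q \<Longrightarrow> polyfun (\<lambda>x. p x + q x)"
  | mult: "polyfun p \<Longrightarrow> polyfun q \<Longrightarrow> polyfun (\<lambda>x. p x * q x)"

text \<open>Here \<open>V\<close> is meant to be a linear subspace: the polynomial functions on \<open>V\<close> are the
  restrictions of those on the ambient space.\<close>

definition zariski_closed_in :: "('a::field ^ 'm) set \<Rightarrow> ('a ^ 'm) set \<Rightarrow> bool"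
  where "zariski_closed_in V Z \<longleftrightarrow>
    (\<exists>P. (\<forall>p\<in>P. polyfun p) \<and> Z = {x \<in> V. \<forall>p\<in>P. p x = 0})"

definition zariski_closure_in :: "('a::field ^ 'm) set \<Rightarrow> ('a ^ 'm) set \<Rightarrow> ('a ^ 'm) set"
  where "zariski_closure_in V S = zariski_closed_in V hull S"


section \<open>Border skew rank\<close>

definition decomposable3 :: "('a::field ^ ('n::finite \<times> 'n \<times> 'n)) set"
  where "decomposable3 = {wedge3 a b c | a b c. True}"

definition skew_rank_le :: "nat \<Rightarrow> ('a::field ^ ('n::finite \<times> 'n \<times> 'n)) set"
  where "skew_rank_le s = {\<Sum>i<s. x i | x. \<forall>i<s. x i \<in> decomposable3}"

definition border_skew_rank :: "'a::field ^ ('n::finite \<times> 'n \<times> 'n) \<Rightarrow> nat"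
  where "border_skew_rank T =
    (LEAST s. T \<in> zariski_closure_in alternating3 (skew_rank_le s))"


section \<open>Kruskal rank\<close>

definition subspace_sum :: "'i set \<Rightarrow> ('i \<Rightarrow> ('a::field ^ 'n) set) \<Rightarrow> ('a ^ 'n) set"
  where "subspace_sum I U = {\<Sum>i\<in>I. u i | u. \<forall>i\<in>I. u i \<in> U i}"

text \<open>The multiset \<open>{U\<^sub>1, \<dots>, U\<^sub>r}\<close> is given as a family over a finite index set \<open>I\<close>; the
  sub-multisets are the subfamilies.  The bound \<open>l \<le> card I\<close> excludes the vacuous values
  of \<open>l\<close>, for which there are no subfamilies of size \<open>l\<close>.\<close>

definition kruskal_rank :: "'i set \<Rightarrow> ('i \<Rightarrow> ('a::field ^ 'n) set) \<Rightarrow> nat"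
  where "kruskal_rank I U =
    Max {l. l \<le> card I \<and>
      (\<forall>J. J \<subseteq> I \<and> card J = l \<longrightarrow>
        vec.dim (subspace_sum J U) = (\<Sum>j\<in>J. vec.dim (U j)))}"

end

theory Submission
  imports Defs "HOL-Library.Poly_Mapping" "HOL-Computational_Algebra.Polynomial_Factorial"
begin

text \<open>Contracting \<open>T\<close> with a covector \<open>\<phi>\<close> gives an \<open>n \<times> n\<close> matrix that depends linearly on \<open>T\<close>,
  and the contraction of a single \<open>a \<and> b \<and> c\<close> has rank at most 2, with image \<open>\<langle>a, b, c\<rangle> \<inter> ker \<phi>\<close>
  when \<open>\<phi>\<close> does not vanish on \<open>\<langle>a, b, c\<rangle>\<close>. So it suffices that for a generic \<open>\<phi>\<close> the planes
  \<open>U\<^sub>i \<inter> ker \<phi>\<close> are in direct sum: then the contraction of \<open>T\<close> has rank \<open>2r\<close>, and a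
  determinant separates \<open>T\<close> from all tensors of smaller skew rank. To have generic covectors over every field,
  take \<open>\<phi> = (X\<^sub>1, \<dots>, X\<^sub>n)\<close> over \<open>F = K(X\<^sub>1, \<dots>, X\<^sub>n)\<close>; \<open>K\<close>-linear functionals on \<open>F\<close>
  turn the determinant into polynomials over \<open>K\<close>.

  For the direct sum, suppose \<open>\<Sum>u\<^sub>i = 0\<close> with \<open>u\<^sub>i \<in> U\<^sub>i \<inter> ker \<phi>\<close>, nonzero exactly for \<open>i \<in> S\<close>. The space
  \<open>N\<close> of relations \<open>\<Sum>z\<^sub>i = 0\<close>, \<open>z\<^sub>i \<in> U\<^sub>i\<close>, supported in \<open>S\<close> has dimension at most \<open>3(|S| - k)\<close>.
  On the other hand, let \<open>d\<close> be the dimension of the span of the \<open>u\<^sub>i\<close>. Each linear relation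
  \<open>\<Sum>\<lambda>\<^sub>iu\<^sub>i = 0\<close> gives the element \<open>(\<lambda>\<^sub>iu\<^sub>i)\<close> of the kernel of \<open>\<phi> : N \<rightarrow> F\<^sup>S\<close>, and differentiating
  \<open>\<phi>(u\<^sub>i) = 0\<close> by \<open>X\<^sub>j\<close> shows that the vector of \<open>j\<close>-th coordinates of the \<open>u\<^sub>i\<close> lies in \<open>\<phi>(N)\<close>. Hence
  \<open>dim N \<ge> (|S| - d) + d = |S|\<close>, so \<open>3k \<le> 2|S| \<le> 2r\<close>, contrary to the assumption.\<close>

section \<open>Linear algebra over a field\<close>

definition indep_family :: "'p set \<Rightarrow> ('p \<Rightarrow> 'a::field ^ 'n) \<Rightarrow> bool"
  where "indep_family P v \<longleftrightarrow> (\<forall>x. (\<Sum>p\<in>P. x p *s v p) = 0 \<longrightarrow> (\<forall>p\<in>P. x p = 0))"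

lemma indep_familyD:
  assumes "indep_family P v" "(\<Sum>p\<in>P. x p *s v p) = 0" "p \<in> P"
  shows "x p = 0"
  using assms unfolding indep_family_def by blast

lemma indep_family_inj_on:
  assumes "finite P" "indep_family P v"
  shows "inj_on v P"
proof (rule inj_onI, rule ccontr)
  fix p q assume pq: "p \<in> P" "q \<in> P" "v p = v q" "p \<noteq> q"
  let ?x = "\<lambda>s. if s = p then 1 else if s = q then -1 else 0"
  have "(\<Sum>s\<in>P. ?x s *s v s) = (\<Sum>s\<in>{p,q}. ?x s *s v s)"
    using assms(1) pq by (intro sum.mono_neutral_right) auto
  also have "\<dots> = 0" using pq by simp
  finally show False using indep_familyD[OF assms(2) _ pq(1), of ?x] by simp
qed

lemma indep_family_independent:
  assumes "finite P" "indep_family P v"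
  shows "vec.independent (v ` P)"
proof (rule vec.independent_if_scalars_zero)
  fix f y assume 0: "(\<Sum>x\<in>v ` P. f x *s x) = 0" and "y \<in> v ` P"
  then show "f y = 0"
    using indep_familyD[OF assms(2), of "f \<circ> v"]
    by (auto simp: sum.reindex[OF indep_family_inj_on[OF assms]])
qed (use assms in simp)

lemma dim_indep_family:
  assumes "finite P" "indep_family P v"
  shows "vec.dim (v ` P) = card P"
  using assms by (simp add: vec.dim_eq_card_independent indep_family_independent card_image indep_family_inj_on)

lemma indep_familyI_dim:
  assumes "finite P" "card P \<le> vec.dim (v ` P)"
  shows "indep_family P v"
proof -
  have "vec.dim (v ` P) \<le> card (v ` P)"
    using assms(1) by (intro vec.dim_le_card) (auto intro: vec.span_base)
  then have c: "card (v ` P) = card P"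
    using assms card_image_le[OF assms(1), of v] by simp
  then have inj: "inj_on v P" using assms(1) by (simp add: eq_card_imp_inj_on)
  have ind: "vec.independent (v ` P)"
    using assms c by (intro vec.card_le_dim_spanning[where V = "vec.span (v ` P)"])
      (auto intro: vec.span_base)
  show ?thesis
    unfolding indep_family_def
  proof (intro allI impI ballI)
    fix x p assume 0: "(\<Sum>p\<in>P. x p *s v p) = 0" and p: "p \<in> P"
    have "(\<Sum>b\<in>v ` P. x (the_inv_into P v b) *s b) = 0"
      using 0 by (simp add: sum.reindex[OF inj] the_inv_into_f_f[OF inj])
    then have "x (the_inv_into P v (v p)) = 0"
      using vec.independentD[OF ind, of "v ` P" "\<lambda>b. x (the_inv_into P v b)" "v p"] assms(1) p by auto
    then show "x p = 0" using p by (simp add: the_inv_into_f_f[OF inj])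
  qed
qed

lemma span_Int_span_independent:
  fixes A B :: "('a::field ^ 'n) set"
  assumes "vec.independent (A \<union> B)" "A \<inter> B = {}"
  shows "vec.span A \<inter> vec.span B = {0}"
proof -
  have fin: "finite A" "finite B"
    using assms(1) vec.independent_bound_general[of "A \<union> B"] by auto
  have "vec.dim {x + y |x y. x \<in> vec.span A \<and> y \<in> vec.span B} + vec.dim (vec.span A \<inter> vec.span B)
      = vec.dim (vec.span A) + vec.dim (vec.span B)"
    by (rule vec.dim_sums_Int) (rule vec.subspace_span)+
  also have "{x + y |x y. x \<in> vec.span A \<and> y \<in> vec.span B} = vec.span (A \<union> B)"
    unfolding vec.span_Un by simp
  finally have "card (A \<union> B) + vec.dim (vec.span A \<inter> vec.span B) = card A + card B"
    using assms(1) vec.independent_mono[OF assms(1), of A] vec.independent_mono[OF assms(1), of B]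
    by (simp add: vec.dim_eq_card_independent)
  then have "vec.dim (vec.span A \<inter> vec.span B) = 0"
    using card_Un_disjoint[OF fin assms(2)] by simp
  then show ?thesis using vec.span_zero by auto
qed

lemma rank_nullity:
  fixes f :: "'a::field ^ 'm \<Rightarrow> 'a ^ 'n"
  assumes f: "Vector_Spaces.linear (*s) (*s) f" and N: "vec.subspace N"
  shows "vec.dim N = vec.dim {x \<in> N. f x = 0} + vec.dim (f ` N)"
proof -
  interpret f: Vector_Spaces.linear "(*s)" "(*s)" f by fact
  let ?K = "{x \<in> N. f x = 0}"
  obtain B where B: "B \<subseteq> ?K" "vec.independent B" "?K \<subseteq> vec.span B" "card B = vec.dim ?K"
    using vec.basis_exists by blast
  obtain C where C: "B \<subseteq> C" "C \<subseteq> N" "vec.independent C" "N \<subseteq> vec.span C"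
    using vec.maximal_independent_subset_extend[of B N] B by blast
  have fC: "finite C" using C(3) vec.independent_bound_general by blast
  have sN: "vec.span C = N" using C vec.span_subspace[OF C(2) C(4) N] by simp
  have inj: "inj_on f (vec.span (C - B))"
    unfolding f.inj_on_iff_eq_0[OF vec.subspace_span]
  proof (intro ballI impI)
    fix x assume x: "x \<in> vec.span (C - B)" "f x = 0"
    have "x \<in> N" using x vec.span_mono[of "C - B" C] sN by auto
    then have "x \<in> vec.span B" using x B by auto
    moreover have "vec.span (C - B) \<inter> vec.span B = {0}"
      using C(1,3) by (intro span_Int_span_independent) (auto simp: Un_absorb2)
    ultimately show "x = 0" using x by auto
  qed
  have "f ` N = vec.span (f ` C)" using sN f.span_image by metis
  also have "\<dots> = vec.span (f ` (C - B))"
  proof -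
    have "f ` C \<subseteq> insert 0 (f ` (C - B))" using B(1) by auto
    then have "vec.span (f ` C) \<subseteq> vec.span (f ` (C - B))"
      by (metis vec.span_insert_0 vec.span_mono)
    then show ?thesis by (metis Diff_subset image_mono subset_antisym vec.span_mono)
  qed
  finally have "vec.dim (f ` N) = vec.dim (f ` (C - B))" by simp
  also have "\<dots> = vec.dim (C - B)" using f inj by (rule vec.dim_image_eq)
  also have "\<dots> = card (C - B)"
    using C(3) vec.independent_mono[of C "C - B"] by (simp add: vec.dim_eq_card_independent)
  finally have "vec.dim (f ` N) = card (C - B)" .
  moreover have "vec.dim N = card C" using C vec.basis_card_eq_dim by metis
  ultimately show ?thesis using B C(1) fC
    by (metis card_Diff_subset card_mono finite_subset le_add_diff_inverse)
qed

text \<open>The library has the equality of row rank and column rank only over the reals.\<close>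

lemma row_rank_le_column_rank:
  fixes A :: "'a::field ^ 'n ^ 'm"
  shows "vec.dim (rows A) \<le> vec.dim (columns A)"
proof -
  obtain B where B: "B \<subseteq> columns A" "vec.independent B" "columns A \<subseteq> vec.span B" "card B = vec.dim (columns A)"
    using vec.basis_exists by blast
  have fB: "finite B" using B(2) vec.independent_bound_general by blast
  have "\<exists>\<beta>. column k A = (\<Sum>b\<in>B. \<beta> b *s b)" for k
  proof -
    have "column k A \<in> vec.span B" using B(3) by (auto simp: columns_def)
    then show ?thesis using vec.span_finite[OF fB] by auto
  qed
  then obtain \<beta> where \<beta>: "\<And>k. column k A = (\<Sum>b\<in>B. \<beta> k b *s b)" by metis
  have "rows A \<subseteq> vec.span ((\<lambda>b. \<chi> k. \<beta> k b) ` B)"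
  proof
    fix x assume "x \<in> rows A"
    then obtain i where i: "x = row i A" by (auto simp: rows_def)
    have "x $ k = (\<Sum>b\<in>B. b $ i *s (\<chi> k. \<beta> k b)) $ k" for k
      using arg_cong[OF \<beta>, of "\<lambda>c. c $ i" k] by (simp add: i row_def column_def mult.commute)
    then have "x = (\<Sum>b\<in>B. b $ i *s (\<chi> k. \<beta> k b))" by (simp add: vec_eq_iff)
    then show "x \<in> vec.span ((\<lambda>b. \<chi> k. \<beta> k b) ` B)"
      by (simp only:) (intro vec.span_sum vec.span_scale vec.span_base imageI)
  qed
  then have "vec.dim (rows A) \<le> card ((\<lambda>b. \<chi> k. \<beta> k b) ` B)"
    using fB by (intro vec.dim_le_card) auto
  also have "\<dots> \<le> card B" using fB by (rule card_image_le)
  finally show ?thesis using B by simp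
qed


section \<open>Field extensions and polynomial functions\<close>

locale field_embedding =
  fixes \<iota> :: "'a::field \<Rightarrow> 'f::field"
  assumes hom_1: "\<iota> 1 = 1"
    and hom_add: "\<iota> (x + y) = \<iota> x + \<iota> y"
    and hom_mult: "\<iota> (x * y) = \<iota> x * \<iota> y"
begin

lemma hom_0: "\<iota> 0 = 0"
  using hom_add[of 0 0] by (simp only: add_0_left add_cancel_right_right)

lemma hom_minus: "\<iota> (- x) = - \<iota> x"
  using hom_add[of x "- x"] hom_0 by (simp add: eq_neg_iff_add_eq_0 add.commute)

lemma hom_diff: "\<iota> (x - y) = \<iota> x - \<iota> y"
  using hom_add[of x "- y"] hom_minus by simp

lemma hom_eq_0_iff: "\<iota> x = 0 \<longleftrightarrow> x = 0"
  using hom_0 hom_1 hom_mult[of x "inverse x"] by (cases "x = 0") auto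

definition vmap :: "'a ^ 'n \<Rightarrow> 'f ^ 'n"
  where "vmap x = (\<chi> i. \<iota> (x $ i))"

lemma vmap_nth [simp]: "vmap x $ i = \<iota> (x $ i)"
  by (simp add: vmap_def)

definition functional :: "('f \<Rightarrow> 'a) \<Rightarrow> bool"
  where "functional g \<longleftrightarrow> (\<forall>x y. g (x + y) = g x + g y) \<and> (\<forall>c x. g (\<iota> c * x) = c * g x)"

lemma functional_0: "functional g \<Longrightarrow> g 0 = 0"
  unfolding functional_def by (metis add_cancel_left_left add.right_neutral)

lemma functional_sum: "functional g \<Longrightarrow> g (sum f A) = (\<Sum>i\<in>A. g (f i))"
  by (induction A rule: infinite_finite_induct) (simp_all add: functional_0 functional_def)

lemma ex_functional:
  assumes "x \<noteq> 0"
  shows "\<exists>g. functional g \<and> g x = 1"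
proof -
  interpret vs: vector_space_pair "\<lambda>c x. \<iota> c * x" "(*) :: 'a \<Rightarrow> 'a \<Rightarrow> 'a"
    by unfold_locales (simp_all add: algebra_simps hom_add hom_mult hom_1)
  have "vs.vs1.independent {x}" using assms by simp
  from vs.linear_independent_extend[OF this, of "\<lambda>_. 1"] obtain g where
    g: "Vector_Spaces.linear (\<lambda>c x. \<iota> c * x) (*) g" "g x = 1" by auto
  have "functional g"
    using g(1) unfolding functional_def Vector_Spaces.linear_iff by simp
  then show ?thesis using g(2) by blast
qed

lemma indep_family_vmap:
  assumes "indep_family P v"
  shows "indep_family P (\<lambda>p. vmap (v p))"
  unfolding indep_family_def
proof (intro allI impI ballI, rule ccontr)
  fix x p assume 0: "(\<Sum>p\<in>P. x p *s vmap (v p)) = 0" and p: "p \<in> P" "x p \<noteq> 0"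
  obtain g where g: "functional g" "g (x p) = 1" using ex_functional[OF p(2)] by blast
  have "(\<Sum>p\<in>P. g (x p) *s v p) $ i = 0" for i
  proof -
    have "(\<Sum>p\<in>P. g (x p) *s v p) $ i = (\<Sum>p\<in>P. g (\<iota> (v p $ i) * x p))"
      using g by (simp add: functional_def mult.commute)
    also have "\<dots> = g ((\<Sum>p\<in>P. x p *s vmap (v p)) $ i)"
      by (simp add: functional_sum[OF g(1)] mult.commute)
    finally show ?thesis using g(1) by (simp add: 0 functional_0)
  qed
  then have "(\<Sum>p\<in>P. g (x p) *s v p) = 0" by (simp add: vec_eq_iff)
  then have "g (x p) = 0" using indep_familyD[OF assms, of "\<lambda>p. g (x p)"] p by simp
  then show False using g by simp
qed

text \<open>Functions of the form \<open>\<Sum>\<^sub>l \<iota>(p\<^sub>l(x)) d\<^sub>l\<close>: closed under products, and carried to polynomial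
  functions over the small field by every linear functional.\<close>

inductive extpoly :: "('a ^ 'm \<Rightarrow> 'f) \<Rightarrow> bool"
  where
    monom: "polyfun p \<Longrightarrow> extpoly (\<lambda>x. \<iota> (p x) * d)"
  | add: "extpoly f \<Longrightarrow> extpoly g \<Longrightarrow> extpoly (\<lambda>x. f x + g x)"

lemma extpoly_const: "extpoly (\<lambda>_. d)"
  using extpoly.monom[OF polyfun.const[of 1], of d] by (simp add: hom_1)

lemma extpoly_mult:
  assumes "extpoly f" "extpoly g"
  shows "extpoly (\<lambda>x. f x * g x)"
  using assms(1)
proof induction
  case (monom p d)
  from assms(2) show ?case
  proof induction
    case (monom q e)
    have "extpoly (\<lambda>x. \<iota> (p x * q x) * (d * e))"
      by (intro extpoly.monom polyfun.mult monom \<open>polyfun p\<close>)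
    then show ?case by (simp add: hom_mult mult_ac)
  next
    case (add f g)
    then show ?case using extpoly.add by (simp add: distrib_left)
  qed
next
  case (add f h)
  then show ?case using extpoly.add by (simp add: distrib_right)
qed

lemma extpoly_sum: "(\<And>i. i \<in> A \<Longrightarrow> extpoly (f i)) \<Longrightarrow> extpoly (\<lambda>x. \<Sum>i\<in>A. f i x)"
  by (induction A rule: infinite_finite_induct) (simp_all add: extpoly_const extpoly.add)

lemma extpoly_prod: "(\<And>i. i \<in> A \<Longrightarrow> extpoly (f i)) \<Longrightarrow> extpoly (\<lambda>x. \<Prod>i\<in>A. f i x)"
  by (induction A rule: infinite_finite_induct) (simp_all add: extpoly_const extpoly_mult)

lemma extpoly_det:
  assumes "\<And>i j. extpoly (\<lambda>x. M x $ i $ j)"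
  shows "extpoly (\<lambda>x. det (M x))"
  unfolding det_def by (intro extpoly_sum extpoly_mult extpoly_prod extpoly_const assms)

lemma polyfun_functional:
  assumes "extpoly f" "functional g"
  shows "polyfun (\<lambda>x. g (f x))"
  using assms(1)
proof induction
  case (monom p d)
  then show ?case using assms(2) polyfun.mult[OF monom polyfun.const[of "g d"]] by (simp add: functional_def)
next
  case (add f h)
  then show ?case using assms(2) polyfun.add by (simp add: functional_def)
qed

end


section \<open>The generic linear form\<close>

text \<open>The variables are numbered, because the absence of zero divisors is available only for
  linearly ordered monomials.\<close>

type_synonym 'a mpoly = "(nat \<Rightarrow>\<^sub>0 nat) \<Rightarrow>\<^sub>0 'a"

definition mvar :: "nat \<Rightarrow> 'a::field mpoly"
  where "mvar j = Poly_Mapping.single (Poly_Mapping.single j 1) 1"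

definition mconst :: "'a \<Rightarrow> 'a::field mpoly"
  where "mconst c = Poly_Mapping.single 0 c"

lift_definition mderiv :: "nat \<Rightarrow> 'a::field mpoly \<Rightarrow> 'a mpoly"
  is "\<lambda>k p m. of_nat (Poly_Mapping.lookup m k + 1) * p (m + Poly_Mapping.single k 1)"
proof -
  fix k and p :: "(nat \<Rightarrow>\<^sub>0 nat) \<Rightarrow> 'a" assume "finite {m. p m \<noteq> 0}"
  then have "finite ((\<lambda>m. m + Poly_Mapping.single k 1) -` {m. p m \<noteq> 0})"
    by (rule finite_vimageI) (simp add: inj_def)
  then show "finite {m. of_nat (Poly_Mapping.lookup m k + 1) * p (m + Poly_Mapping.single k 1) \<noteq> 0}"
    by (rule rev_finite_subset) auto
qed

lemma mderiv_0 [simp]: "mderiv k 0 = 0"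
  by transfer simp

lemma mderiv_add: "mderiv k (p + q) = mderiv k p + mderiv k q"
  by transfer (simp add: distrib_left)

lemma mderiv_sum: "mderiv k (sum f A) = (\<Sum>i\<in>A. mderiv k (f i))"
  by (induction A rule: infinite_finite_induct) (simp_all add: mderiv_add)

lemma mderiv_single:
  "mderiv k (Poly_Mapping.single m c)
    = Poly_Mapping.single (m - Poly_Mapping.single k 1) (of_nat (Poly_Mapping.lookup m k) * c)"
proof (rule poly_mapping_eqI)
  fix n :: "nat \<Rightarrow>\<^sub>0 nat"
  show "Poly_Mapping.lookup (mderiv k (Poly_Mapping.single m c)) n
    = Poly_Mapping.lookup (Poly_Mapping.single (m - Poly_Mapping.single k 1) (of_nat (Poly_Mapping.lookup m k) * c)) n"
  proof (cases "m = n + Poly_Mapping.single k 1")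
    case True
    then show ?thesis by (simp add: mderiv.rep_eq lookup_add lookup_single)
  next
    case False
    have "Poly_Mapping.lookup m k = 0" if "m - Poly_Mapping.single k 1 = n"
    proof (rule ccontr)
      assume "Poly_Mapping.lookup m k \<noteq> 0"
      then have "m = n + Poly_Mapping.single k 1"
        unfolding that[symmetric]
        by (intro poly_mapping_eqI) (auto simp: lookup_add lookup_minus lookup_single when_def)
      then show False using False by simp
    qed
    then show ?thesis using False by (auto simp: mderiv.rep_eq lookup_single when_def)
  qed
qed

lemma mpoly_induct [case_names single add]:
  assumes "\<And>m c. P (Poly_Mapping.single m c)" "\<And>p q. P p \<Longrightarrow> P q \<Longrightarrow> P (p + q)"
  shows "P (p :: 'a::field mpoly)"
proof (induction p rule: update_induct)
  case const
  then show ?case using assms(1)[of 0 0] by simp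
next
  case (update f a b)
  have "Poly_Mapping.update a b f = f + Poly_Mapping.single a b"
    using update by (intro poly_mapping_eqI) (auto simp: lookup_update lookup_add lookup_single when_def in_keys_iff)
  then show ?case using assms update by simp
qed

lemma mderiv_mconst_mult: "mderiv k (mconst c * p) = mconst c * mderiv k p"
  by (induction p rule: mpoly_induct)
    (simp_all add: mconst_def mult_single mderiv_single distrib_left distrib_right mderiv_add mult_ac)

lemma mderiv_mvar_mult:
  "mderiv k (mvar j * p) = mvar j * mderiv k p + (if j = k then p else 0)"
proof (induction p rule: mpoly_induct)
  case (single m c)
  show ?case
  proof (cases "Poly_Mapping.lookup m k = 0")
    case True
    then show ?thesis
      by (auto simp: mvar_def mult_single mderiv_single lookup_add lookup_single when_def single_zero)
  next
    case False
    then have "Poly_Mapping.single j 1 + (m - Poly_Mapping.single k 1)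
      = Poly_Mapping.single j 1 + m - Poly_Mapping.single k 1"
      by (intro poly_mapping_eqI) (auto simp: lookup_add lookup_minus lookup_single when_def)
    then show ?thesis
      by (auto simp: mvar_def mult_single mderiv_single lookup_add lookup_single when_def
        distrib_right single_add)
  qed
next
  case (add p q)
  then show ?case by (simp add: distrib_left mderiv_add)
qed

lemma common_denominator:
  fixes x :: "'p \<Rightarrow> 'd::idom fract"
  assumes "finite P"
  shows "\<exists>q y. q \<noteq> 0 \<and> (\<forall>p\<in>P. to_fract q * x p = to_fract (y p))"
  using assms
proof induction
  case empty
  then show ?case by (auto intro: exI[of _ 1])
next
  case (insert s P)
  then obtain q y where q: "q \<noteq> 0" "\<And>p. p \<in> P \<Longrightarrow> to_fract q * x p = to_fract (y p)" by blast
  obtain a b where ab: "x s = Fract a b" "b \<noteq> 0" by (cases "x s") auto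
  have s: "to_fract b * x s = to_fract a"
    using ab by (simp add: to_fract_def eq_fract)
  have eq: "to_fract (b * q) * x p = to_fract (if p = s then q * a else b * y p)" if "p \<in> insert s P" for p
  proof (cases "p = s")
    case True
    have "to_fract (b * q) * x s = to_fract q * (to_fract b * x s)" by (simp add: mult_ac)
    then show ?thesis using True s by simp
  next
    case False
    then show ?thesis using q that by (simp add: mult.assoc)
  qed
  show ?case
    by (rule exI[of _ "b * q"], rule exI[of _ "\<lambda>p. if p = s then q * a else b * y p"])
      (use q(1) ab(2) eq in \<open>simp del: to_fract_mult\<close>)
qed

definition embed_const :: "'a::field \<Rightarrow> 'a mpoly fract"
  where "embed_const c = to_fract (mconst c)"

lemma mconst_add: "mconst (a + b) = mconst a + mconst b"
  by (simp add: mconst_def single_add)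

lemma mconst_mult: "mconst (a * b) = mconst a * mconst b"
  by (simp add: mconst_def mult_single)

lemma mconst_1: "mconst 1 = 1"
  by (simp add: mconst_def)

interpretation embed: field_embedding embed_const
  by unfold_locales (simp_all add: embed_const_def mconst_1 mconst_add mconst_mult)

definition gform_poly :: "'a::field ^ 'n::finite \<Rightarrow> 'a mpoly"
  where "gform_poly a = (\<Sum>j\<in>UNIV. mvar (to_nat j) * mconst (a $ j))"

definition gform :: "'a::field ^ 'n::finite \<Rightarrow> 'a mpoly fract"
  where "gform a = (\<Sum>j\<in>UNIV. to_fract (mvar (to_nat j)) * embed_const (a $ j))"

lemma to_fract_gform_poly: "to_fract (gform_poly a) = gform a"
  by (simp add: gform_def gform_poly_def to_fract_sum embed_const_def)

lemma mderiv_mult_gform_poly: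
  "mderiv (to_nat k) (y * gform_poly a) = mderiv (to_nat k) y * gform_poly a + y * mconst (a $ k)"
proof -
  have "mderiv (to_nat k) (y * gform_poly a)
      = mderiv (to_nat k) (\<Sum>j\<in>UNIV. mvar (to_nat j) * (mconst (a $ j) * y))"
    by (simp add: gform_poly_def sum_distrib_left mult_ac)
  also have "\<dots> = (\<Sum>j\<in>UNIV. mvar (to_nat j) * (mconst (a $ j) * mderiv (to_nat k) y))
      + (\<Sum>j\<in>UNIV. if j = k then mconst (a $ j) * y else 0)"
    by (simp add: mderiv_sum mderiv_mvar_mult mderiv_mconst_mult sum.distrib)
  also have "\<dots> = mderiv (to_nat k) y * gform_poly a + y * mconst (a $ k)"
    by (simp add: gform_poly_def sum_distrib_left mult_ac)
  finally show ?thesis .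
qed

lemma gform_eq_0_iff: "gform a = 0 \<longleftrightarrow> a = 0"
proof
  assume "gform a = 0"
  then have 0: "1 * gform_poly a = 0" by (simp flip: to_fract_gform_poly)
  have "mderiv j (1 :: 'a mpoly) = 0" for j
    using mderiv_single[of j 0 1] by simp
  then have "Poly_Mapping.lookup (mconst (a $ k)) 0 = 0" for k
    using mderiv_mult_gform_poly[of k 1 a] unfolding 0 by simp
  then show "a = 0"
    by (simp add: vec_eq_iff mconst_def)
qed (simp add: gform_def embed.hom_0)


section \<open>Generic hyperplane sections\<close>

lemma embed_rel_numerator:
  fixes v :: "'p::finite \<Rightarrow> 'a::field ^ 'n::finite" and Y :: "'p \<Rightarrow> 'a mpoly"
  shows "(\<Sum>p\<in>UNIV. to_fract (Y p) *s embed.vmap (v p)) = 0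
    \<longleftrightarrow> (\<forall>j. (\<Sum>p\<in>UNIV. mconst (v p $ j) * Y p) = 0)"
  by (simp add: vec_eq_iff embed_const_def mult.commute flip: to_fract_sum to_fract_mult)

lemma generic_section_independent:
  fixes v :: "'s::finite \<times> 't::finite \<Rightarrow> 'a::field ^ 'n::finite"
    and x :: "'s \<times> 't \<Rightarrow> 'a mpoly fract"
  assumes kruskal: "\<And>J. J \<subseteq> I \<Longrightarrow> card J = k \<Longrightarrow> indep_family (J \<times> UNIV) v"
    and k: "k \<le> card I"
    and bound: "(CARD('t) - 1) * card I < CARD('t) * k"
    and rel: "(\<Sum>p\<in>I \<times> UNIV. x p *s embed.vmap (v p)) = 0"
    and sect: "\<And>i. i \<in> I \<Longrightarrow> (\<Sum>t\<in>UNIV. x (i, t) * gform (v (i, t))) = 0"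
    and p: "p \<in> I \<times> UNIV"
  shows "x p = 0"
proof (rule ccontr)
  assume "x p \<noteq> 0"
  obtain q y where q: "q \<noteq> 0" "\<And>p. to_fract q * x p = to_fract (y p)"
    using common_denominator[of UNIV x] by auto
  define Y where "Y = (\<lambda>p. if p \<in> I \<times> UNIV then y p else 0)"
  define S where "S = {i. \<exists>t. Y (i, t) \<noteq> 0}"
  have "S \<subseteq> I" by (auto simp: S_def Y_def)
  have Y_outside: "Y p = 0" if "fst p \<notin> S" for p
    using that by (cases p) (auto simp: S_def)

  have "(\<Sum>p\<in>UNIV. to_fract (Y p) *s embed.vmap (v p))
      = (\<Sum>p\<in>I \<times> UNIV. to_fract (y p) *s embed.vmap (v p))"
    by (rule sum.mono_neutral_cong_right) (auto simp: Y_def)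
  also have "\<dots> = to_fract q *s (\<Sum>p\<in>I \<times> UNIV. x p *s embed.vmap (v p))"
    by (simp add: vec.scale_sum_right q(2))
  finally have Y_rel: "(\<Sum>p\<in>UNIV. to_fract (Y p) *s embed.vmap (v p)) = 0"
    by (simp add: rel)
  have Y_section: "(\<Sum>t\<in>UNIV. Y (i, t) * gform_poly (v (i, t))) = 0" for i
  proof (cases "i \<in> I")
    case True
    have "to_fract (\<Sum>t\<in>UNIV. Y (i, t) * gform_poly (v (i, t)))
        = to_fract q * (\<Sum>t\<in>UNIV. x (i, t) * gform (v (i, t)))"
      using True by (simp add: to_fract_sum to_fract_gform_poly Y_def q(2)[symmetric]
        sum_distrib_left mult.assoc)
    then show ?thesis unfolding sect[OF True] mult_zero_right to_fract_eq_0_iff .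
  qed (simp add: Y_def)

  define \<sigma> where "\<sigma> = (\<lambda>z :: 'a mpoly fract ^ ('s \<times> 't). \<Sum>p\<in>UNIV. z $ p *s embed.vmap (v p))"
  define M where "M = (\<lambda>z :: 'a mpoly fract ^ ('s \<times> 't). (\<chi> i. \<Sum>t\<in>UNIV. z $ (i, t) * gform (v (i, t))) :: 'a mpoly fract ^ 's)"
  define U where "U = (\<chi> i. \<Sum>t\<in>UNIV. to_fract (Y (i, t)) *s embed.vmap (v (i, t)))"
  define N where "N = {z. (\<forall>p. fst p \<notin> S \<longrightarrow> z $ p = 0) \<and> \<sigma> z = 0}"
  define G where "G = (\<lambda>l :: 'a mpoly fract ^ 's. (\<chi> p. l $ fst p * to_fract (Y p)) :: 'a mpoly fract ^ ('s \<times> 't))"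
  define \<rho> where "\<rho> = (\<lambda>l :: 'a mpoly fract ^ 's. \<Sum>i\<in>UNIV. l $ i *s (U $ i))"
  define V where "V = {l :: 'a mpoly fract ^ 's. \<forall>i. i \<notin> S \<longrightarrow> l $ i = 0}"
  have lin_\<sigma>: "Vector_Spaces.linear (*s) (*s) \<sigma>"
    unfolding \<sigma>_def by unfold_locales
      (simp_all add: vec.scale_left_distrib sum.distrib vec.scale_sum_right)
  have lin_M: "Vector_Spaces.linear (*s) (*s) M"
    unfolding M_def by unfold_locales
      (simp_all add: vec_eq_iff distrib_right sum.distrib sum_distrib_left mult.assoc)
  have lin_G: "Vector_Spaces.linear (*s) (*s) G"
    unfolding G_def by unfold_locales (simp_all add: vec_eq_iff distrib_right mult.assoc)
  have lin_\<rho>: "Vector_Spaces.linear (*s) (*s) \<rho>"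
    unfolding \<rho>_def by unfold_locales
      (simp_all add: vec.scale_left_distrib sum.distrib vec.scale_sum_right)
  have sub_N: "vec.subspace N"
    using lin_\<sigma> by (auto simp: N_def vec.subspace_def Vector_Spaces.linear_iff) (metis vec.scale_zero_left)
  have sub_V: "vec.subspace V"
    by (auto simp: V_def vec.subspace_def)

  have "columns U \<subseteq> M ` N"
  proof
    fix c assume "c \<in> columns U"
    then obtain j where c: "c = column j U" by (auto simp: columns_def)
    define z :: "'a mpoly fract ^ ('s \<times> 't)" where "z = (\<chi> p. - to_fract (mderiv (to_nat j) (Y p)))"
    have "(\<Sum>p\<in>UNIV. mconst (v p $ i) * mderiv (to_nat j) (Y p)) = 0" for i
      using arg_cong[of _ _ "mderiv (to_nat j)", OF Y_rel[unfolded embed_rel_numerator, rule_format, of i]]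
      by (simp add: mderiv_sum mderiv_mconst_mult)
    then have "\<sigma> z = 0"
      using embed_rel_numerator[of "\<lambda>p. mderiv (to_nat j) (Y p)" v]
      by (simp add: \<sigma>_def z_def sum_negf)
    then have "z \<in> N" by (simp add: N_def z_def Y_outside)
    moreover have "M z = c"
    proof (rule vec_eq_iff[THEN iffD2], rule allI)
      fix i
      have "(\<Sum>t\<in>UNIV. mderiv (to_nat j) (Y (i, t)) * gform_poly (v (i, t)))
          + (\<Sum>t\<in>UNIV. Y (i, t) * mconst (v (i, t) $ j)) = 0"
        using arg_cong[of _ _ "mderiv (to_nat j)", OF Y_section[of i]]
        by (simp add: mderiv_sum mderiv_mult_gform_poly sum.distrib)
      from arg_cong[of _ _ to_fract, OF this]
      show "M z $ i = c $ i"
        by (simp add: M_def z_def c column_def U_def to_fract_sum to_fract_gform_poly embed_const_def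
          sum_negf neg_eq_iff_add_eq_0 add.commute)
    qed
    ultimately show "c \<in> M ` N" by blast
  qed
  then have dim_MN: "vec.dim (columns U) \<le> vec.dim (M ` N)"
    by (rule vec.dim_subset)

  have "G ` {l \<in> V. \<rho> l = 0} \<subseteq> {z \<in> N. M z = 0}"
  proof clarsimp
    fix l assume "l \<in> V" and l: "\<rho> l = 0"
    have "\<sigma> (G l) = (\<Sum>i\<in>UNIV. \<Sum>t\<in>UNIV. (l $ i * to_fract (Y (i, t))) *s embed.vmap (v (i, t)))"
      unfolding UNIV_Times_UNIV[symmetric] \<sigma>_def G_def by (simp add: sum.cartesian_product case_prod_beta)
    also have "\<dots> = \<rho> l" by (simp add: \<rho>_def U_def vec.scale_sum_right)
    finally have "G l \<in> N" using l by (simp add: N_def G_def Y_outside)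
    moreover have "M (G l) $ i = 0" for i
    proof -
      have "M (G l) $ i = l $ i * to_fract (\<Sum>t\<in>UNIV. Y (i, t) * gform_poly (v (i, t)))"
        by (simp add: M_def G_def to_fract_sum to_fract_gform_poly sum_distrib_left mult.assoc)
      then show ?thesis by (simp add: Y_section)
    qed
    ultimately show "G l \<in> N \<and> M (G l) = 0" by (simp add: vec_eq_iff)
  qed
  then have "vec.dim (G ` {l \<in> V. \<rho> l = 0}) \<le> vec.dim {z \<in> N. M z = 0}"
    by (rule vec.dim_subset)
  moreover have "vec.dim (G ` {l \<in> V. \<rho> l = 0}) = vec.dim {l \<in> V. \<rho> l = 0}"
  proof (rule vec.dim_image_eq[OF lin_G])
    have "vec.span {l \<in> V. \<rho> l = 0} \<subseteq> V"
      using sub_V by (intro vec.span_minimal) auto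
    moreover have "inj_on G V"
    proof (rule inj_onI)
      fix l l' assume l: "l \<in> V" "l' \<in> V" "G l = G l'"
      have "l $ i = l' $ i" for i
      proof (cases "i \<in> S")
        case True
        then obtain t where "Y (i, t) \<noteq> 0" by (auto simp: S_def)
        moreover have "G l $ (i, t) = G l' $ (i, t)" using l by simp
        ultimately show ?thesis by (simp add: G_def)
      qed (use l in \<open>simp add: V_def\<close>)
      then show "l = l'" by (simp add: vec_eq_iff)
    qed
    ultimately show "inj_on G (vec.span {l \<in> V. \<rho> l = 0})" by (rule inj_on_subset[rotated])
  qed
  ultimately have dim_ker: "vec.dim {l \<in> V. \<rho> l = 0} \<le> vec.dim {z \<in> N. M z = 0}" by simp

  have "\<rho> ` V \<subseteq> vec.span (rows U)"
    unfolding \<rho>_def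
    by (intro image_subsetI vec.span_sum vec.span_scale vec.span_base) (auto simp: rows_def row_def vec_nth_inverse)
  then have "vec.dim (\<rho> ` V) \<le> vec.dim (rows U)" by (metis vec.dim_span vec.dim_subset)
  also have "\<dots> \<le> vec.dim (columns U)" by (rule row_rank_le_column_rank)
  finally have "card S \<le> vec.dim {l \<in> V. \<rho> l = 0} + vec.dim (columns U)"
    using rank_nullity[OF lin_\<rho> sub_V] dim_substandard_cart[of S, where ?'a = "'a mpoly fract"]
    by (simp add: V_def)
  then have lower: "card S \<le> vec.dim N"
    using rank_nullity[OF lin_M sub_N] dim_ker dim_MN by linarith

  have supported: "z $ p = 0"
    if "z \<in> N" "J \<subseteq> I" "card J = k" "\<And>p. fst p \<notin> J \<Longrightarrow> z $ p = 0" for z J p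
  proof -
    have "(\<Sum>p\<in>J \<times> UNIV. z $ p *s embed.vmap (v p)) = \<sigma> z"
      unfolding \<sigma>_def
    proof (intro sum.mono_neutral_left ballI)
      fix p :: "'s \<times> 't" assume "p \<in> UNIV - J \<times> UNIV"
      then have "fst p \<notin> J" by (simp add: mem_Times_iff)
      then show "z $ p *s embed.vmap (v p) = 0" by (simp add: that(4))
    qed auto
    then have "z $ p = 0" if "p \<in> J \<times> UNIV"
      using indep_familyD[OF embed.indep_family_vmap[OF kruskal] _ that, of "($) z"] \<open>z \<in> N\<close> that
        \<open>J \<subseteq> I\<close> \<open>card J = k\<close>
      by (simp add: N_def)
    then show ?thesis using that(4) by (cases "fst p \<in> J") (auto simp: mem_Times_iff)
  qed

  have "k < card S"
  proof (rule ccontr)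
    assume "\<not> k < card S"
    then obtain J where J: "S \<subseteq> J" "J \<subseteq> I" "card J = k"
      using exists_subset_between[of S k I] k \<open>S \<subseteq> I\<close> by auto
    have "(\<chi> p. to_fract (Y p)) \<in> N"
      using Y_rel by (simp add: N_def \<sigma>_def Y_outside)
    from supported[OF this J(2,3), of p] J(1) have "Y p = 0"
      using Y_outside by auto
    then have "to_fract q * x p = 0" using q(2)[of p] p by (simp add: Y_def)
    then show False using q(1) \<open>x p \<noteq> 0\<close> by simp
  qed
  then obtain J where J: "J \<subseteq> S" "card J = k"
    by (meson less_imp_le obtain_subset_with_card_n)
  define P where "P = (\<lambda>z :: 'a mpoly fract ^ ('s \<times> 't). (\<chi> p. if fst p \<in> J then 0 else z $ p) :: 'a mpoly fract ^ ('s \<times> 't))"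
  have lin_P: "Vector_Spaces.linear (*s) (*s) P"
    unfolding P_def by unfold_locales (simp_all add: vec_eq_iff)
  have "inj_on P (vec.span N)"
  proof -
    interpret P: Vector_Spaces.linear "(*s)" "(*s)" P by (rule lin_P)
    show ?thesis
      unfolding P.inj_on_iff_eq_0[OF sub_N] vec.span_eq_iff[THEN iffD2, OF sub_N]
    proof (intro ballI impI)
      fix z assume z: "z \<in> N" "P z = 0"
      have "z $ p = 0" if "fst p \<notin> J" for p
        using that arg_cong[OF z(2), of "\<lambda>w. w $ p"] by (simp add: P_def)
      then show "z = 0"
        using supported[OF z(1), of J] J \<open>S \<subseteq> I\<close> by (simp add: vec_eq_iff)
    qed
  qed
  then have "vec.dim N = vec.dim (P ` N)" by (rule vec.dim_image_eq[OF lin_P, symmetric])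
  also have "\<dots> \<le> vec.dim {z :: 'a mpoly fract ^ ('s \<times> 't). \<forall>p. p \<notin> (S - J) \<times> UNIV \<longrightarrow> z $ p = 0}"
    by (rule vec.dim_subset) (auto simp: P_def N_def)
  also have "\<dots> = (card S - k) * CARD('t)"
    unfolding dim_substandard_cart using J by (simp add: card_cartesian_product card_Diff_subset)
  finally have "card S \<le> (card S - k) * CARD('t)" using lower by linarith
  moreover have "(card S - k) * CARD('t) + k * CARD('t) = card S * CARD('t)"
    using \<open>k < card S\<close> by (simp flip: distrib_right)
  ultimately have "card S + k * CARD('t) \<le> card S * CARD('t)" by linarith
  moreover have "(CARD('t) - 1) * card S + card S = card S * CARD('t)"
    by (cases "CARD('t)") auto
  ultimately have "CARD('t) * k \<le> (CARD('t) - 1) * card S"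
    by (simp add: mult.commute)
  also have "\<dots> \<le> (CARD('t) - 1) * card I"
    using \<open>S \<subseteq> I\<close> by (simp add: card_mono)
  finally show False using bound by simp
qed


section \<open>Contraction of alternating tensors\<close>

lemma permutes_insertE:
  assumes "\<sigma> permutes insert a S"
  obtains b \<tau> where "b \<in> insert a S" "\<sigma> = Transposition.transpose a b \<circ> \<tau>" "\<tau> permutes S"
proof -
  have "\<sigma> \<in> {\<sigma>. \<sigma> permutes insert a S}" using assms by simp
  then show thesis
    unfolding permutes_insert using that by (elim imageE) auto
qed

lemma permutes_3_cases:
  assumes "\<sigma> permutes {..<3::nat}"
  obtains p q where "p \<in> {0, 1, 2}" "q \<in> {1, 2}"
    "\<sigma> = Transposition.transpose 0 p \<circ> Transposition.transpose 1 q"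
proof -
  have eq: "{..<3::nat} = insert 0 (insert 1 {2})" by auto
  obtain p \<tau> where p: "p \<in> insert 0 (insert 1 {2})" "\<sigma> = Transposition.transpose 0 p \<circ> \<tau>"
    and \<tau>: "\<tau> permutes insert 1 {2}"
    using assms unfolding eq by (rule permutes_insertE)
  obtain q \<rho> where q: "q \<in> insert 1 {2}" "\<tau> = Transposition.transpose 1 q \<circ> \<rho>" "\<rho> permutes {2}"
    using \<tau> by (rule permutes_insertE)
  then show thesis using that[of p q] p by simp
qed

lemma wedge3_nth:
  "wedge3 x y z $ (i, j, k) = 1 / of_nat (fact 3) *
    (x $ i * y $ j * z $ k - x $ i * z $ j * y $ k - y $ i * x $ j * z $ k
      + y $ i * z $ j * x $ k + z $ i * x $ j * y $ k - z $ i * y $ j * x $ k)"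
proof -
  have f: "finite {1::nat, 2}" "(0::nat) \<notin> {1, 2}" "finite {2::nat}" "(1::nat) \<notin> {2}" by auto
  have eq: "{..<3::nat} = {0, 1, 2}" by auto
  show ?thesis
    unfolding wedge3_def eq sum_over_permutations_insert[OF f(1,2)] sum_over_permutations_insert[OF f(3,4)]
      permutes_sing
    by (simp add: sign_swap_id permutation_swap_id sign_compose sign_id swap_id_eq tensor3_def
      Transposition.transpose_def algebra_simps)
qed

lemma wedge3_alternating: "wedge3 x y z \<in> alternating3"
  unfolding alternating3_def
proof (intro CollectI allI impI)
  fix \<sigma> :: "nat \<Rightarrow> nat" and i j k assume "\<sigma> permutes {..<3}"
  then obtain p q where "p \<in> {0, 1, 2}" "q \<in> {1, 2}"
    and \<sigma>: "\<sigma> = Transposition.transpose 0 p \<circ> Transposition.transpose 1 q"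
    by (rule permutes_3_cases)
  then show "wedge3 x y z $ ([i, j, k] ! \<sigma> 0, [i, j, k] ! \<sigma> 1, [i, j, k] ! \<sigma> 2)
      = of_int (sign \<sigma>) * wedge3 x y z $ (i, j, k)"
    unfolding \<sigma> by (auto simp: sign_swap_id permutation_swap_id sign_compose sign_id
      Transposition.transpose_def wedge3_nth algebra_simps)
qed

lemma alternating3_sum:
  assumes "\<And>i. i \<in> A \<Longrightarrow> f i \<in> alternating3"
  shows "sum f A \<in> alternating3"
  using assms unfolding alternating3_def
  by (auto simp: sum_distrib_left intro!: sum.cong)

lemma skew_rank_le_alternating: "skew_rank_le s \<subseteq> alternating3"
  by (auto simp: skew_rank_le_def decomposable3_def intro!: alternating3_sum)
    (metis wedge3_alternating)

lemma wedge3_zero_left: "wedge3 0 y z = 0"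
  by (simp add: vec_eq_iff wedge3_nth)

lemma wedge3_nonzero_indep_family:
  assumes "wedge3 a b c \<noteq> 0"
  shows "indep_family UNIV (\<lambda>t. (vector [a, b, c] :: ('a::field ^ 'n::finite) ^ 3) $ t)"
  unfolding indep_family_def
proof (intro allI impI ballI)
  fix x :: "3 \<Rightarrow> 'a" and t
  assume "(\<Sum>t\<in>UNIV. x t *s (vector [a, b, c] :: ('a ^ 'n) ^ 3) $ t) = 0"
  then have 0: "x 1 * a $ i + x 2 * b $ i + x 3 * c $ i = 0" for i
    by (simp add: sum_3 vec_eq_iff)
  have zero: "y1 * (A $ i * B $ j * C $ k - A $ i * C $ j * B $ k - B $ i * A $ j * C $ k
      + B $ i * C $ j * A $ k + C $ i * A $ j * B $ k - C $ i * B $ j * A $ k) = 0" (is "_ * ?v = 0")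
    if "\<And>i. y1 * A $ i + y2 * B $ i + y3 * C $ i = 0" for y1 y2 y3 i j k and A B C :: "'a ^ 'n"
  proof -
    let ?e = "\<lambda>i. y1 * A $ i + y2 * B $ i + y3 * C $ i"
    have "y1 * ?v = ?e i * (B $ j * C $ k - C $ j * B $ k) - ?e j * (B $ i * C $ k - C $ i * B $ k)
        + ?e k * (B $ i * C $ j - C $ i * B $ j)"
      by (simp add: algebra_simps)
    then show ?thesis by (simp add: that)
  qed
  have "x t * wedge3 a b c $ (i, j, k) = 0" for i j k
  proof -
    let ?w = "\<lambda>a b c :: 'a ^ 'n. a $ i * b $ j * c $ k - a $ i * c $ j * b $ k - b $ i * a $ j * c $ k
      + b $ i * c $ j * a $ k + c $ i * a $ j * b $ k - c $ i * b $ j * a $ k"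
    have w: "?w b c a = ?w a b c" "?w c a b = ?w a b c" by (simp_all add: algebra_simps)
    have "x 1 * ?w a b c = 0" using 0 by (rule zero)
    moreover have "x 2 * ?w b c a = 0" by (rule zero[of _ _ "x 3" _ "x 1"]) (use 0 in \<open>simp add: add_ac\<close>)
    moreover have "x 3 * ?w c a b = 0" by (rule zero[of _ _ "x 1" _ "x 2"]) (use 0 in \<open>simp add: add_ac\<close>)
    ultimately have xw: "x t * ?w a b c = 0" unfolding w using exhaust_3[of t] by (elim disjE) simp_all
    show ?thesis
      unfolding wedge3_nth mult.left_commute[of "x t" "1 / of_nat (fact 3)"] xw by (rule mult_zero_right)
  qed
  then show "x t = 0" using assms by (auto simp: vec_eq_iff)
qed

definition contract :: "'a::field ^ ('n::finite \<times> 'n \<times> 'n) \<Rightarrow> 'a mpoly fract ^ 'n ^ 'n"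
  where "contract T = (\<chi> i j. \<Sum>l\<in>UNIV. to_fract (mvar (to_nat l)) * embed_const (T $ (l, i, j)))"

text \<open>If \<open>a \<noteq> 0\<close>, then \<open>pivot a b\<close> and \<open>pivot a c\<close> span the zeros of the generic form in \<open>\<langle>a, b, c\<rangle>\<close>.\<close>

definition pivot :: "'a::field ^ 'n::finite \<Rightarrow> 'a ^ 'n \<Rightarrow> 'a mpoly fract ^ 'n"
  where "pivot a b = gform a *s embed.vmap b - gform b *s embed.vmap a"

definition dot :: "'f::field ^ 'n::finite \<Rightarrow> 'f ^ 'n \<Rightarrow> 'f"
  where "dot x y = (\<Sum>j\<in>UNIV. x $ j * y $ j)"

lemma contract_0 [simp]: "contract 0 = 0"
  by (simp add: contract_def vec_eq_iff embed.hom_0)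

lemma contract_add: "contract (S + T) = contract S + contract T"
  by (simp add: contract_def vec_eq_iff embed.hom_add distrib_left sum.distrib)

lemma contract_sum_mult: "contract (sum f A) *v y = (\<Sum>i\<in>A. contract (f i) *v y)"
  by (induction A rule: infinite_finite_induct)
    (simp_all add: contract_add matrix_vector_mult_add_rdistrib)

lemma contract_wedge3_nth:
  "contract (wedge3 a b c) $ i $ j = embed_const (1 / of_nat (fact 3)) *
    (gform a * (embed_const (b $ i) * embed_const (c $ j) - embed_const (c $ i) * embed_const (b $ j))
    - gform b * (embed_const (a $ i) * embed_const (c $ j) - embed_const (c $ i) * embed_const (a $ j))
    + gform c * (embed_const (a $ i) * embed_const (b $ j) - embed_const (b $ i) * embed_const (a $ j)))"
  unfolding contract_def gform_def wedge3_nth embed.hom_mult embed.hom_add embed.hom_diff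
  by (simp add: sum_distrib_left sum_distrib_right sum.distrib sum_subtractf algebra_simps)

lemma contract_wedge3_mult:
  assumes "a \<noteq> 0"
  shows "contract (wedge3 a b c) *v y = (embed_const (1 / of_nat (fact 3)) / gform a) *s
    (dot (pivot a c) y *s pivot a b - dot (pivot a b) y *s pivot a c)"
proof -
  have a: "gform a \<noteq> 0" using assms by (simp add: gform_eq_0_iff)
  have "contract (wedge3 a b c) $ i $ j = (embed_const (1 / of_nat (fact 3)) / gform a) *
      (pivot a b $ i * pivot a c $ j - pivot a c $ i * pivot a b $ j)" for i j
  proof -
    have "pivot a b $ i * pivot a c $ j - pivot a c $ i * pivot a b $ j
      = gform a * (gform a * (embed_const (b $ i) * embed_const (c $ j) - embed_const (c $ i) * embed_const (b $ j))
    - gform b * (embed_const (a $ i) * embed_const (c $ j) - embed_const (c $ i) * embed_const (a $ j))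
    + gform c * (embed_const (a $ i) * embed_const (b $ j) - embed_const (b $ i) * embed_const (a $ j)))"
      by (simp add: pivot_def algebra_simps)
    then show ?thesis using a by (simp add: contract_wedge3_nth)
  qed
  then show ?thesis
    by (simp add: vec_eq_iff matrix_vector_mult_def dot_def sum_distrib_left sum_distrib_right
      right_diff_distrib left_diff_distrib sum_subtractf mult_ac)
qed

text \<open>Adding the projection to suitable coordinates completes a matrix of rank \<open>2r\<close> to an invertible
  one, so that \<open>n \<times> n\<close> determinants can replace minors of size \<open>2r\<close>.\<close>

definition coord_proj :: "'n set \<Rightarrow> 'f::field ^ 'n::finite ^ 'n"
  where "coord_proj L = (\<chi> i j. if i = j \<and> i \<in> L then 1 else 0)"

lemma coord_proj_mult: "coord_proj L *v y = (\<Sum>l\<in>L. y $ l *s axis l 1)"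
proof -
  have "(coord_proj L *v y) $ i = (\<Sum>l\<in>L. y $ l *s axis l 1) $ i" for i
  proof -
    have "(coord_proj L *v y) $ i = (\<Sum>j\<in>UNIV. if j = i then (if i \<in> L then y $ i else 0) else 0)"
      unfolding matrix_vector_mult_def coord_proj_def vec_lambda_beta by (rule sum.cong) auto
    also have "\<dots> = (\<Sum>l\<in>L. if l = i then y $ l else 0)" by simp
    also have "\<dots> = (\<Sum>l\<in>L. y $ l *s axis l 1) $ i"
      unfolding sum_component by (rule sum.cong) (auto simp: axis_def)
    finally show ?thesis .
  qed
  then show ?thesis by (simp add: vec_eq_iff)
qed

lemma contract_low_rank:
  assumes "T \<in> skew_rank_le s"
  shows "\<exists>B. finite B \<and> card B \<le> 2 * s \<and> (\<forall>y. contract T *v y \<in> vec.span B)"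
proof -
  obtain x where T: "T = (\<Sum>i<s. x i)" and x: "\<And>i. i < s \<Longrightarrow> x i \<in> decomposable3"
    using assms by (auto simp: skew_rank_le_def)
  have "\<exists>a b c. x i = wedge3 a b c" if "i < s" for i
    using x[OF that] by (auto simp: decomposable3_def)
  then obtain a b c where abc: "\<And>i. i < s \<Longrightarrow> x i = wedge3 (a i) (b i) (c i)" by metis
  define B where "B = (\<lambda>i. pivot (a i) (b i)) ` {..<s} \<union> (\<lambda>i. pivot (a i) (c i)) ` {..<s}"
  have "contract (x i) *v y \<in> vec.span B" if "i < s" for i y
  proof (cases "a i = 0")
    case True
    then show ?thesis by (simp add: abc[OF that] wedge3_zero_left vec.span_zero)
  next
    case False
    then show ?thesis
      unfolding abc[OF that] contract_wedge3_mult[OF False]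
      using that by (intro vec.span_scale vec.span_diff vec.span_base) (auto simp: B_def)
  qed
  then have "contract T *v y \<in> vec.span B" for y
    unfolding T contract_sum_mult by (intro vec.span_sum) auto
  moreover have "card B \<le> card {..<s} + card {..<s}"
    unfolding B_def by (rule order_trans[OF card_Un_le add_mono]) (rule card_image_le, simp)+
  moreover have "finite B" by (simp add: B_def)
  ultimately show ?thesis by (intro exI[of _ B]) auto
qed

lemma det_contract_eq_0:
  fixes T :: "'a::field ^ ('n::finite \<times> 'n \<times> 'n)"
  assumes "T \<in> skew_rank_le s" and L: "2 * s + card L < CARD('n)"
  shows "det (contract T + coord_proj L) = 0"
proof (rule ccontr)
  let ?A = "contract T + coord_proj L"
  assume "det ?A \<noteq> 0"
  then have "surj ((*v) ?A)"
    unfolding invertible_det_nz[symmetric] invertible_right_inverse matrix_right_invertible_surjective .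
  obtain B where B: "finite B" "card B \<le> 2 * s" "\<And>y. contract T *v y \<in> vec.span B"
    using contract_low_rank[OF assms(1)] by blast
  let ?E = "(\<lambda>l. axis l 1) ` L :: ('a mpoly fract ^ 'n) set"
  have in_span: "?A *v y \<in> vec.span (B \<union> ?E)" for y
    unfolding matrix_vector_mult_add_rdistrib coord_proj_mult
  proof (intro vec.span_add vec.span_sum vec.span_scale)
    show "contract T *v y \<in> vec.span (B \<union> ?E)"
      using B(3) vec.span_mono[of B "B \<union> ?E"] by auto
  qed (auto intro: vec.span_base)
  then have "UNIV \<subseteq> vec.span (B \<union> ?E)" 
    using image_subsetI[of UNIV "(*v) ?A", OF in_span] \<open>surj ((*v) ?A)\<close> by simp
  then have "vec.dim (UNIV :: ('a mpoly fract ^ 'n) set) \<le> card (B \<union> ?E)"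
    using B(1) by (intro vec.dim_le_card) auto
  also have "\<dots> \<le> card B + card L"
    by (rule order_trans[OF card_Un_le]) (simp add: card_image_le)
  finally show False using B(2) L by (simp add: vec_dim_card card_cart_basis)
qed

lemma ex_det_contract_nonzero:
  fixes a b c :: "nat \<Rightarrow> 'a::field ^ 'n::finite"
  assumes six: "of_nat (fact 3) \<noteq> (0 :: 'a)"
    and a: "\<And>i. i \<in> R \<Longrightarrow> a i \<noteq> 0" and R: "finite R"
    and ind: "indep_family (R \<times> UNIV) (\<lambda>(i, e). if e then pivot (a i) (b i) else pivot (a i) (c i))"
  shows "\<exists>L. 2 * card R + card L = CARD('n) \<and>
    det (contract (\<Sum>i\<in>R. wedge3 (a i) (b i) (c i)) + coord_proj L) \<noteq> 0"
proof -
  define f where "f = (\<lambda>(i, e). if e then pivot (a i) (b i) else pivot (a i) (c i))"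
  note ind = ind[folded f_def]
  let ?W = "f ` (R \<times> UNIV)" and ?ax = "\<lambda>l :: 'n. axis l 1 :: 'a mpoly fract ^ 'n"
  have indW: "vec.independent ?W" using ind R by (intro indep_family_independent) auto
  have "inj_on f (R \<times> UNIV)" using ind R by (intro indep_family_inj_on) auto
  then have cardW: "card ?W = 2 * card R"
    by (simp add: card_image card_cartesian_product)
  obtain B where B: "?W \<subseteq> B" "B \<subseteq> ?W \<union> range ?ax" "vec.independent B" "?W \<union> range ?ax \<subseteq> vec.span B"
    using vec.maximal_independent_subset_extend[of ?W "?W \<union> range ?ax"] indW by blast
  have "range ?ax = cart_basis" by (auto simp: cart_basis_def)
  then have "UNIV = vec.span (range ?ax)" by (simp add: span_cart_basis)
  also have "\<dots> \<subseteq> vec.span B" using B(4) by (intro vec.span_minimal) auto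
  finally have spanB: "vec.span B = UNIV" by auto
  define L where "L = {l. ?ax l \<in> B - ?W}"
  have axL: "?ax ` L = B - ?W" using B(2) by (auto simp: L_def)
  have "inj ?ax" by (auto simp: inj_def axis_eq_axis)
  then have "card L = card (B - ?W)"
    using card_image[of ?ax L] axL by (simp add: inj_on_subset)
  moreover have "card B = CARD('n)"
    using vec.dim_eq_card[OF _ B(3), of UNIV] spanB by (simp add: vec_dim_card card_cart_basis)
  moreover have "finite B" using B(3) vec.independent_bound_general by blast
  ultimately have "2 * card R + card L = CARD('n)"
    using B(1) cardW by (metis card_Diff_subset card_mono finite_subset le_add_diff_inverse)
  moreover have "det (contract (\<Sum>i\<in>R. wedge3 (a i) (b i) (c i)) + coord_proj L) \<noteq> 0" (is "det (?C + _) \<noteq> 0")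
  proof -
    have "y = 0" if y: "(?C + coord_proj L) *v y = 0" for y
    proof -
      let ?g = "\<lambda>i. embed_const (1 / of_nat (fact 3)) / gform (a i)"
      let ?x = "\<lambda>(i, e). if e then ?g i * dot (pivot (a i) (c i)) y else - (?g i * dot (pivot (a i) (b i)) y)"
      have Cy: "?C *v y = (\<Sum>p\<in>R \<times> UNIV. ?x p *s f p)"
      proof -
        have "?C *v y = (\<Sum>i\<in>R. \<Sum>e\<in>UNIV. ?x (i, e) *s f (i, e))"
          unfolding contract_sum_mult
          using a by (intro sum.cong refl)
            (simp add: contract_wedge3_mult f_def UNIV_bool vec.scale_right_diff_distrib)
        then show ?thesis unfolding sum.cartesian_product' .
      qed
      have Cspan: "?C *v y \<in> vec.span ?W"
        unfolding Cy by (intro vec.span_sum vec.span_scale vec.span_base) auto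
      have Ey: "coord_proj L *v y = - (?C *v y)"
        using y by (simp add: matrix_vector_mult_add_rdistrib eq_neg_iff_add_eq_0 add.commute)
      have "- (coord_proj L *v y) \<in> vec.span (?ax ` L)"
        unfolding coord_proj_mult
        by (intro vec.span_neg vec.span_sum vec.span_scale vec.span_base) auto
      then have "?C *v y \<in> vec.span (?ax ` L)" unfolding Ey minus_minus .
      with Cspan have "?C *v y \<in> vec.span ?W \<inter> vec.span (?ax ` L)" by (rule IntI)
      also have "\<dots> = {0}"
        unfolding axL using B(1,3) by (intro span_Int_span_independent) (auto simp: Un_absorb1)
      finally have C0: "?C *v y = 0" by simp
      then have E0: "coord_proj L *v y = 0" using Ey by simp
      have "dot (f (i, e)) y = 0" if "i \<in> R" for i e
      proof -
        have "?g i \<noteq> 0"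
          using a[OF that] six by (simp add: embed.hom_eq_0_iff gform_eq_0_iff)
        moreover have "?x (i, \<not> e) = 0"
          using indep_familyD[OF ind, of ?x "(i, \<not> e)"] C0 Cy that by simp
        ultimately show ?thesis by (cases e) (auto simp: f_def)
      qed
      moreover have "dot (?ax l) y = 0" if "l \<in> L" for l
      proof -
        have "(coord_proj L *v y) $ l = y $ l"
          using that unfolding coord_proj_mult by (simp add: axis_def if_distrib cong: if_cong)
        then show ?thesis using E0 by (simp add: dot_def axis_def if_distrib if_distribR cong: if_cong)
      qed
      ultimately have "?W \<union> ?ax ` L \<subseteq> {b. dot b y = 0}" by auto
      then have "B \<subseteq> {b. dot b y = 0}" unfolding axL by blast
      moreover have "vec.subspace {b. dot b y = 0}"
        by (auto simp: vec.subspace_def dot_def distrib_right sum.distrib mult.assoc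
          simp flip: sum_distrib_left)
      ultimately have "vec.span B \<subseteq> {b. dot b y = 0}" by (rule vec.span_minimal)
      then have "dot (?ax j) y = 0" for j using spanB by auto
      then show "y = 0"
        by (simp add: vec_eq_iff dot_def axis_def if_distrib if_distribR cong: if_cong)
    qed
    then have "inj ((*v) (?C + coord_proj L))"
      by (simp add: vec.inj_iff_eq_0)
    then show ?thesis
      unfolding invertible_det_nz[symmetric] invertible_left_inverse matrix_left_invertible_injective .
  qed
  ultimately show ?thesis by blast
qed

lemma extpoly_contract: "embed.extpoly (\<lambda>T. det (contract T + coord_proj L))"
proof (rule embed.extpoly_det)
  fix i j
  have "embed.extpoly (\<lambda>T :: 'a ^ ('b \<times> 'b \<times> 'b). (\<Sum>l\<in>UNIV. embed_const (T $ (l, i, j)) * to_fract (mvar (to_nat l))) + coord_proj L $ i $ j)"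
    by (intro embed.extpoly.add embed.extpoly_sum embed.extpoly.monom polyfun.coord embed.extpoly_const)
  then show "embed.extpoly (\<lambda>T :: 'a ^ ('b \<times> 'b \<times> 'b). (contract T + coord_proj L) $ i $ j)"
    by (simp add: contract_def mult.commute)
qed


section \<open>Border skew rank under the Kruskal condition\<close>

lemma kruskal_rank_props:
  assumes "finite I"
  shows "kruskal_rank I U \<le> card I"
    and "J \<subseteq> I \<Longrightarrow> card J = kruskal_rank I U \<Longrightarrow>
      vec.dim (subspace_sum J U) = (\<Sum>j\<in>J. vec.dim (U j))"
proof -
  let ?K = "{l. l \<le> card I \<and> (\<forall>J. J \<subseteq> I \<and> card J = l \<longrightarrow>
    vec.dim (subspace_sum J U) = (\<Sum>j\<in>J. vec.dim (U j)))}"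
  have "0 \<in> ?K"
    using assms by (auto simp: subspace_sum_def dest: finite_subset)
  moreover have "finite ?K" by simp
  ultimately have "kruskal_rank I U \<in> ?K"
    unfolding kruskal_rank_def by (intro Max_in) auto
  then show "kruskal_rank I U \<le> card I"
    and "J \<subseteq> I \<Longrightarrow> card J = kruskal_rank I U \<Longrightarrow>
      vec.dim (subspace_sum J U) = (\<Sum>j\<in>J. vec.dim (U j))"
    by auto
qed

lemma zariski_closure_in_lower:
  assumes "S \<subseteq> V" "polyfun p" "\<And>x. x \<in> S \<Longrightarrow> p x = 0" "T \<in> zariski_closure_in V S"
  shows "p T = 0"
proof -
  let ?Z = "{x \<in> V. \<forall>p\<in>{p}. p x = 0}"
  have "zariski_closed_in V ?Z"
    unfolding zariski_closed_in_def using assms(2) by (intro exI[of _ "{p}"]) simp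
  then have "zariski_closed_in V hull S \<subseteq> ?Z"
    using assms by (intro hull_minimal) auto
  then show ?thesis using assms(4) by (auto simp: zariski_closure_in_def)
qed

lemma border_skew_rank_eqI:
  fixes T :: "'a::field ^ ('n::finite \<times> 'n \<times> 'n)"
  assumes "T \<in> skew_rank_le r" "det (contract T + coord_proj L) \<noteq> 0" "2 * r + card L = CARD('n)"
  shows "border_skew_rank T = r"
  unfolding border_skew_rank_def
proof (rule Least_equality)
  show "T \<in> zariski_closure_in alternating3 (skew_rank_le r)"
    using assms(1) by (simp add: zariski_closure_in_def hull_inc)
next
  fix s assume T: "T \<in> zariski_closure_in alternating3 (skew_rank_le s)"
  obtain g where g: "embed.functional g" "g (det (contract T + coord_proj L)) = 1"
    using embed.ex_functional[OF assms(2)] by blast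
  show "r \<le> s"
  proof (rule ccontr)
    assume "\<not> r \<le> s"
    then have "2 * s + card L < CARD('n)" using assms(3) by simp
    then have "g (det (contract x + coord_proj L)) = 0" if "x \<in> skew_rank_le s" for x
      using det_contract_eq_0[OF that] embed.functional_0[OF g(1)] by simp
    then have "g (det (contract T + coord_proj L)) = 0"
      by (rule zariski_closure_in_lower[OF skew_rank_le_alternating
        embed.polyfun_functional[OF extpoly_contract g(1)] _ T])
    then show False using g(2) by simp
  qed
qed

lemma of_nat_fact_3_nonzero:
  assumes "CHAR('a::field) = 0 \<or> CHAR('a) \<ge> 5"
  shows "of_nat (fact 3) \<noteq> (0 :: 'a)"
proof
  assume "of_nat (fact 3) = (0 :: 'a)"
  then have dvd: "CHAR('a) dvd fact 3" by (simp only: of_nat_eq_0_iff_char_dvd)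
  then have "CHAR('a) \<noteq> 0" using fact_nonzero[of 3, where ?'a = nat] by (metis dvd_0_left)
  then have "prime CHAR('a)" by (intro prime_CHAR_semidom) simp
  then show False using dvd assms \<open>CHAR('a) \<noteq> 0\<close> by (auto simp: prime_dvd_fact_iff)
qed

lemma kruskal_indep_family:
  fixes a b c :: "'i \<Rightarrow> 'a::field ^ 'n::finite"
  defines "U \<equiv> \<lambda>i. vec.span {a i, b i, c i}"
  defines "V \<equiv> \<lambda>i. (vector [a i, b i, c i] :: ('a ^ 'n) ^ 3)"
  assumes "finite I" and nz: "\<And>i. i \<in> I \<Longrightarrow> wedge3 (a i) (b i) (c i) \<noteq> 0"
    and J: "J \<subseteq> I" "card J = kruskal_rank I U"
  shows "indep_family (J \<times> UNIV) (\<lambda>(i, t). V i $ t)"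
proof (rule indep_familyI_dim)
  let ?v = "\<lambda>(i, t). V i $ t"
  have fin: "finite J" using assms by (auto intro: finite_subset)
  then show "finite (J \<times> (UNIV :: 3 set))" by simp
  have U: "U i = vec.span (range (($) (V i)))" for i
    unfolding U_def V_def UNIV_3 by simp
  have "vec.dim (U j) = 3" if "j \<in> J" for j
  proof -
    have "indep_family UNIV (\<lambda>t. V j $ t)"
      unfolding V_def using nz that J by (intro wedge3_nonzero_indep_family) auto
    then show ?thesis using dim_indep_family[of UNIV "\<lambda>t. V j $ t"] by (simp add: U)
  qed
  then have "card (J \<times> (UNIV :: 3 set)) = vec.dim (subspace_sum J U)"
    using kruskal_rank_props(2)[OF \<open>finite I\<close> J] by (simp add: card_cartesian_product)
  also have "\<dots> \<le> vec.dim (vec.span (?v ` (J \<times> UNIV)))"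
  proof (rule vec.dim_subset)
    have "U j \<subseteq> vec.span (?v ` (J \<times> UNIV))" if "j \<in> J" for j
      unfolding U using that by (intro vec.span_mono) force
    then show "subspace_sum J U \<subseteq> vec.span (?v ` (J \<times> UNIV))"
      unfolding subspace_sum_def by (auto intro!: vec.span_sum)
  qed
  finally show "card (J \<times> (UNIV :: 3 set)) \<le> vec.dim (?v ` (J \<times> UNIV))" by simp
qed

lemma indep_family_pivots:
  fixes a b c :: "'i \<Rightarrow> 'a::field ^ 'n::finite"
  defines "U \<equiv> \<lambda>i. vec.span {a i, b i, c i}"
  assumes I: "finite I" and nz: "\<And>i. i \<in> I \<Longrightarrow> wedge3 (a i) (b i) (c i) \<noteq> 0"
    and bound: "2 * card I < 3 * kruskal_rank I U"
  shows "indep_family (I \<times> UNIV) (\<lambda>(i, e). if e then pivot (a i) (b i) else pivot (a i) (c i))"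
proof -
  define V where "V = (\<lambda>i. (vector [a i, b i, c i] :: ('a ^ 'n) ^ 3))"
  define k where "k = kruskal_rank I U"
  have k: "k \<le> card I" unfolding k_def by (rule kruskal_rank_props(1)[OF I])
  have kr: "indep_family (J \<times> UNIV) (\<lambda>(i, t). V i $ t)" if "J \<subseteq> I" "card J = k" for J
    using that kruskal_indep_family[OF I nz, where J = J] by (simp add: V_def k_def U_def)
  have "card I \<le> CARD('n)"
  proof -
    obtain J where J: "J \<subseteq> I" "card J = k" using k by (meson obtain_subset_with_card_n)
    have "finite J" using J I finite_subset by blast
    then have "card (J \<times> (UNIV :: 3 set)) = vec.dim ((\<lambda>(i, t). V i $ t) ` (J \<times> UNIV))"
      using kr[OF J] by (intro dim_indep_family[symmetric]) auto
    also have "\<dots> \<le> CARD('n)"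
      using vec.dim_subset_UNIV by (simp add: vec.dimension_def card_cart_basis)
    finally show ?thesis using J bound by (simp add: card_cartesian_product k_def)
  qed
  \<comment> \<open>The index set is moved into a finite type, to make coefficient families vectors.\<close>
  then obtain h :: "'i \<Rightarrow> 'n" where h: "inj_on h I"
    using card_le_inj[OF I, of "UNIV :: 'n set"] by auto
  define h' where "h' = the_inv_into I h"
  have h'h [simp]: "h' (h i) = i" if "i \<in> I" for i
    using h that by (simp add: h'_def the_inv_into_f_f)
  have "indep_family (J \<times> UNIV) (\<lambda>(i, t). V (h' i) $ t)" if J: "J \<subseteq> h ` I" "card J = k" for J
  proof -
    obtain J' where J': "J' \<subseteq> I" "J = h ` J'" using J(1) by (auto simp: subset_image_iff)
    then have inj: "inj_on h J'" using h inj_on_subset by blast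
    then have "card J' = k" using J J' card_image by metis
    have sum_J: "(\<Sum>p\<in>J \<times> UNIV. F p) = (\<Sum>p\<in>J' \<times> UNIV. F (h (fst p), snd p))" for F :: "'n \<times> 3 \<Rightarrow> 'a ^ 'n"
      unfolding J'(2) by (simp add: sum.cartesian_product' sum.reindex[OF inj])
    show ?thesis
      unfolding indep_family_def
    proof (intro allI impI ballI)
      fix x p assume 0: "(\<Sum>p\<in>J \<times> UNIV. x p *s (case p of (i, t) \<Rightarrow> V (h' i) $ t)) = 0" and p: "p \<in> J \<times> (UNIV :: 3 set)"
      have "(\<Sum>p\<in>J' \<times> UNIV. x (h (fst p), snd p) *s (case p of (i, t) \<Rightarrow> V i $ t)) = 0"
        using J'(1) by (subst 0[symmetric], unfold sum_J) (auto intro!: sum.cong)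
      then show "x p = 0"
        using indep_familyD[OF kr[OF J'(1) \<open>card J' = k\<close>], of "\<lambda>p. x (h (fst p), snd p)"] p J'(2) by auto
    qed
  qed
  note main = generic_section_independent[of "h ` I" k "\<lambda>(i, t). V (h' i) $ t", OF this]
  show ?thesis
    unfolding indep_family_def
  proof (intro allI impI ballI)
    fix y p
    assume 0: "(\<Sum>p\<in>I \<times> UNIV. y p *s (case p of (i, e) \<Rightarrow> if e then pivot (a i) (b i) else pivot (a i) (c i))) = 0"
      and p: "p \<in> I \<times> (UNIV :: bool set)"
    define x where "x = (\<lambda>(i, t :: 3). (vector
      [- (y (h' i, True) * gform (b (h' i)) + y (h' i, False) * gform (c (h' i))),
       y (h' i, True) * gform (a (h' i)), y (h' i, False) * gform (a (h' i))] :: 'a mpoly fract ^ 3) $ t)"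
    have x0: "x q = 0" if "q \<in> h ` I \<times> UNIV" for q
    proof (rule main[where x = x])
      show "k \<le> card (h ` I)" "(CARD(3) - 1) * card (h ` I) < CARD(3) * k"
        using k bound by (simp_all add: card_image[OF h] k_def)
      have "(\<Sum>p\<in>h ` I \<times> UNIV. x p *s embed.vmap (case p of (i, t) \<Rightarrow> V (h' i) $ t))
          = (\<Sum>i\<in>I. \<Sum>t\<in>UNIV. x (h i, t) *s embed.vmap (V i $ t))"
        by (simp add: sum.cartesian_product' sum.reindex[OF h])
      also have "\<dots> = (\<Sum>i\<in>I. \<Sum>e\<in>UNIV. y (i, e) *s (if e then pivot (a i) (b i) else pivot (a i) (c i)))"
        by (intro sum.cong refl)
          (simp add: UNIV_bool sum_3 x_def V_def pivot_def vec_eq_iff algebra_simps)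
      also have "\<dots> = 0" using 0 by (simp add: sum.cartesian_product')
      finally show "(\<Sum>p\<in>h ` I \<times> UNIV. x p *s embed.vmap (case p of (i, t) \<Rightarrow> V (h' i) $ t)) = 0" .
      show "(\<Sum>t\<in>UNIV. x (i, t) * gform (case (i, t) of (i, t) \<Rightarrow> V (h' i) $ t)) = 0" for i
        by (simp add: sum_3 x_def V_def algebra_simps)
    qed (assumption | fact that)+
    obtain i e where ie: "p = (i, e)" "i \<in> I" using p by auto
    have "a i \<noteq> 0" using nz[OF ie(2)] wedge3_zero_left by metis
    then have "gform (a i) \<noteq> 0" by (simp add: gform_eq_0_iff)
    then show "y p = 0"
      using x0[of "(h i, 2)"] x0[of "(h i, 3)"] ie by (cases e) (auto simp: x_def)
  qed
qed

theorem theorem5p6: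
  fixes T :: "'a::field ^ ('n::finite \<times> 'n \<times> 'n)"
    and a b c :: "nat \<Rightarrow> 'a ^ 'n"
    and r k :: nat
  assumes char: "CHAR('a) = 0 \<or> CHAR('a) \<ge> 5"
    and T_alt: "T \<in> alternating3"
    and r_pos: "r \<ge> 1"
    and T_eq: "T = (\<Sum>i=1..r. wedge3 (a i) (b i) (c i))"
    and nonzero: "\<And>i. i \<in> {1..r} \<Longrightarrow> wedge3 (a i) (b i) (c i) \<noteq> 0"
    and k_def: "k = kruskal_rank {1..r} (\<lambda>i. vec.span {a i, b i, c i})"
    and bound: "2 * int r \<le> 3 * int k - 1"
  shows "border_skew_rank T = r"
proof -
  have "indep_family ({1..r} \<times> UNIV) (\<lambda>(i, e). if e then pivot (a i) (b i) else pivot (a i) (c i))"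
    using nonzero bound k_def by (intro indep_family_pivots) auto
  moreover have "a i \<noteq> 0" if "i \<in> {1..r}" for i
    using nonzero[OF that] wedge3_zero_left by metis
  ultimately obtain L :: "'n set" where L: "2 * r + card L = CARD('n)" "det (contract T + coord_proj L) \<noteq> 0"
    using ex_det_contract_nonzero[OF of_nat_fact_3_nonzero[OF char], of "{1..r}" a b c] unfolding T_eq by auto
  have "T = (\<Sum>i<r. wedge3 (a (Suc i)) (b (Suc i)) (c (Suc i)))"
    unfolding T_eq using sum.shift_bounds_Suc_ivl[of "\<lambda>i. wedge3 (a i) (b i) (c i)" 0 r]
    by (simp add: atLeastLessThanSuc_atLeastAtMost atLeast0LessThan)
  then have "T \<in> skew_rank_le r"
    unfolding skew_rank_le_def decomposable3_def by blast
  then show ?thesis using L(2,1) by (rule border_skew_rank_eqI)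
qed

end
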